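(* Assume the following. (1) $F$ is twice continuously differentiable and convex with $0\preceq \nabla^2F(\theta)\preceq L_f I_d$ for all $\theta\in\mathbb{R}^d$, and there exist $\delta_1,\lambda>0$ such that $\nabla^2F(\theta)\succeq\lambda I_d$ for all $\theta$ in the $\delta_1$-ball centered at $\theta^\star$. (2) $\mathbb{E}[\nabla f(\theta;\zeta)]=\nabla F(\theta)$ for all $\theta$, and for some $0<\delta\le 2$ there exists $M>0$ such that $\mathbb{E}\|\nabla f(\theta;\zeta)-\nabla F(\theta)\|^{2+\delta}\le M(\|\theta-\theta^\star\|^{2+\delta}+1)$ for all $\theta$. (3) There are $L_h,L_p>0$ such that for all $\theta,\theta'$, $\mathbb{E}\|\nabla^2f(\theta;\zeta)-\nabla^2f(\theta';\zeta)\|^2\le L_h\|\theta-\theta'\|^2$, and $\mathbb{E}\|[\nabla^2f(\theta^\star;\zeta)]^2-[\nabla^2F(\theta^\star)]^2\|\le L_p$. Let $S=\mathbb{E}[\nabla f(\theta^\star;\zeta)\nabla f(\theta^\star;\zeta)^\top]$ and, for a direction distribution $\mathcal{P}_v$ on $\mathbb{R}^d$, let $Q=\mathbb{E}_{v\sim\mathcal{P}_v}[vv^\top Svv^\top]$. Then for the following choices of $\mathcal{P}_v$: (G) Gaussian, $v\sim\mathcal{N}(0,I_d)$: $Q=2S+\mathrm{tr}(S)I_d$. (S) Spherical, $v$ uniform on the sphere $\{\|v\|^2=d\}$: $Q=\frac{d}{d+2}\left(2S+\mathrm{tr}(S)I_d\right)$. (I) Uniform in the canonical basis, $v$ uniform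 on $\{\sqrt d\,e_1,\dots,\sqrt d\,e_d\}$: $Q=d\,\mathrm{diag}(S)$. (U) Uniform in an arbitrary orthonormal basis, $v$ uniform on $\{\sqrt d\,u_1,\dots,\sqrt d\,u_d\}$ where $U=(u_1,\dots,u_d)$ satisfies $UU^\top=U^\top U=I_d$: $Q=d\,U\,\mathrm{diag}(U^\top SU)\,U^\top$. (P) Non-uniform in the canonical basis, $v=\sqrt{1/p_k}\,e_k$ with probability $p_k>0$ for $k=1,\dots,d$, $\sum_{k=1}^dp_k=1$: $Q=\mathrm{diag}(S_{11}/p_1,\dots,S_{dd}/p_d)$.
   Context: Setting: $\zeta\sim\mathcal{P}_\zeta$ is a random data point, $f(\theta;\zeta)$ is an individual loss, convex in $\theta\in\mathbb{R}^d$, $F(\theta)=\mathbb{E}[f(\theta;\zeta)]$ and $\theta^\star=\mathrm{argmin}\,F$. Derivatives of $f$ are in $\theta$. $\|\cdot\|$ is the Euclidean norm for vectors and the spectral norm for matrices. $e_1,\dots,e_d$ is the canonical basis of $\mathbb{R}^d$. For a matrix $M$, $\mathrm{diag}(M)$ is the diagonal matrix with the same diagonal entries as $M$; $\mathrm{diag}(a_1,\dots,a_d)$ is the diagonal matrix with the listed entries. *)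

theory Defs
  imports "HOL-Probability.Probability"
begin

definition grad :: "('a::euclidean_space \<Rightarrow> real) \<Rightarrow> 'a \<Rightarrow> 'a" where
  "grad f x = (THE D. GDERIV f x :> D)"

lemma GDERIV_grad:
  fixes f :: "'a::euclidean_space \<Rightarrow> real"
  assumes "f differentiable at x"
  shows "GDERIV f x :> grad f x"
proof -
  from assms obtain f' where f': "(f has_derivative f') (at x)"
    by (auto simp: differentiable_def)
  then interpret bounded_linear f'
    by (rule has_derivative_bounded_linear)
  have "f' = (\<lambda>h. h \<bullet> (\<Sum>b\<in>Basis. f' b *\<^sub>R b))"
  proof
    fix h
    have "f' h = f' (\<Sum>b\<in>Basis. (h \<bullet> b) *\<^sub>R b)"
      by (simp add: euclidean_representation)
    then show "f' h = h \<bullet> (\<Sum>b\<in>Basis. f' b *\<^sub>R b)"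
      by (simp add: sum scaleR inner_sum_right mult.commute)
  qed
  then have D: "GDERIV f x :> (\<Sum>b\<in>Basis. f' b *\<^sub>R b)"
    using f' by (simp add: gderiv_def)
  show ?thesis
    unfolding grad_def
  proof (rule theI[where P = "\<lambda>D. GDERIV f x :> D", OF D])
    fix D assume "GDERIV f x :> D"
    with D have "(\<lambda>h. h \<bullet> D) = (\<lambda>h. h \<bullet> (\<Sum>b\<in>Basis. f' b *\<^sub>R b))"
      unfolding gderiv_def by (blast intro: has_derivative_unique)
    then show "D = (\<Sum>b\<in>Basis. f' b *\<^sub>R b)"
      by (simp add: fun_eq_iff vector_eq_ldot)
  qed
qed

definition hess :: "(real^'n \<Rightarrow> real) \<Rightarrow> real^'n \<Rightarrow> real^'n^'n" where
  "hess f x = jacobian (grad f) (at x)"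

definition twice_differentiable :: "(real^'n \<Rightarrow> real) \<Rightarrow> bool" where
  "twice_differentiable f \<longleftrightarrow> (\<forall>x. f differentiable at x) \<and> (\<forall>x. grad f differentiable at x)"

text \<open>The norm of the type \<^typ>\<open>real^'n^'n\<close> is the Frobenius norm, hence a separate spectral norm.\<close>

definition spectral_norm :: "real^'n^'n \<Rightarrow> real" where
  "spectral_norm A = onorm ((*v) A)"

definition loewner_le :: "real^'n^'n \<Rightarrow> real^'n^'n \<Rightarrow> bool" (infix "\<preceq>" 50) where
  "A \<preceq> B \<longleftrightarrow> transpose (B - A) = B - A \<and> (\<forall>x. 0 \<le> x \<bullet> ((B - A) *v x))"

definition outer :: "real^'n \<Rightarrow> real^'n \<Rightarrow> real^'n^'n" where
  "outer u v = (\<chi> i j. u $ i * v $ j)"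

definition diag_mat :: "('n \<Rightarrow> real) \<Rightarrow> real^'n^'n" where
  "diag_mat a = (\<chi> i j. if i = j then a i else 0)"

definition diag_part :: "real^'n^'n \<Rightarrow> real^'n^'n" where
  "diag_part A = diag_mat (\<lambda>i. A $ i $ i)"

definition Qmat :: "real^'n^'n \<Rightarrow> (real^'n) measure \<Rightarrow> real^'n^'n" where
  "Qmat S P = (\<integral>v. outer v v ** S ** outer v v \<partial>P)"

definition gaussian_dir :: "(real^'n) measure" where
  "gaussian_dir = density lborel (\<lambda>v. ennreal (\<Prod>i\<in>UNIV. std_normal_density (v $ i)))"

text \<open>
  The normalised surface measure of a sphere centred at the origin is the cone measure: a subset
  of the sphere has the share of the ball that is taken by the cone over it. So it is the
  radial projection of the uniform distribution on the ball (the value at the origin is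
  irrelevant). The lemmas below confirm that it is a probability measure carried by the sphere
  and invariant under all orthogonal transformations, which determines it uniquely.
\<close>

definition uniform_sphere :: "real \<Rightarrow> (real^'n) measure" where
  "uniform_sphere r = distr (uniform_measure lborel (ball 0 1)) borel (\<lambda>x. (r / norm x) *\<^sub>R x)"

lemma prob_space_uniform_ball:
  "prob_space (uniform_measure lborel (ball (0::real^'n) 1))"
proof (rule prob_space_uniform_measure)
  have "measure lborel (ball (0::real^'n) 1) > 0"
    by (simp add: content_ball_pos)
  then show "emeasure lborel (ball (0::real^'n) 1) \<noteq> 0"
    by (auto simp: measure_def)
  show "emeasure lborel (ball (0::real^'n) 1) \<noteq> \<infinity>"
    using emeasure_lborel_ball_finite[of "0::real^'n" 1] by simp
qed

lemma prob_space_uniform_sphere: "prob_space (uniform_sphere r :: (real^'n) measure)"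
  unfolding uniform_sphere_def
  by (rule prob_space.prob_space_distr[OF prob_space_uniform_ball]) simp

lemma AE_uniform_sphere:
  assumes "0 \<le> r"
  shows "AE v in (uniform_sphere r :: (real^'n) measure). norm v = r"
proof -
  have "AE x in lborel. x \<noteq> (0::real^'n)"
    by (rule AE_lborel_singleton)
  then have "AE x in uniform_measure lborel (ball (0::real^'n) 1). x \<noteq> 0"
    by (intro AE_uniform_measureI) auto
  then have "AE x in uniform_measure lborel (ball (0::real^'n) 1). norm ((r / norm x) *\<^sub>R x) = r"
    by eventually_elim (use assms in auto)
  then show ?thesis
    unfolding uniform_sphere_def by (subst AE_distr_iff) auto
qed

lemma distr_lborel_orthogonal:
  fixes T :: "real^'n \<Rightarrow> real^'n"
  assumes T: "orthogonal_transformation T"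
  shows "distr lborel borel T = lborel"
proof (rule measure_eqI)
  have lin: "linear T" using T by (rule orthogonal_transformation_linear)
  have meas [measurable]: "T \<in> borel_measurable borel"
    using lin by (intro borel_measurable_continuous_onI linear_continuous_on linear_conv_bounded_linear[THEN iffD1])
  have TI: "T (inv T y) = y" for y
    using orthogonal_transformation_surj[OF T] by (rule surj_f_inv_f)
  let ?B = "ball (0::real^'n) 1"
  have shift: "(\<integral>\<^sup>+x. g (c + x) \<partial>lborel) = (\<integral>\<^sup>+x. g x \<partial>lborel)"
    if [measurable]: "g \<in> borel_measurable borel" for g :: "real^'n \<Rightarrow> ennreal" and c
  proof -
    have "(\<integral>\<^sup>+x. g x \<partial>lborel) = (\<integral>\<^sup>+x. g x \<partial>distr lborel borel ((+) c))"
      by (simp add: lborel_distr_plus)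
    then show ?thesis by (simp add: nn_integral_distr)
  qed
  fix A assume "A \<in> sets (distr lborel borel T)"
  then have A [measurable]: "A \<in> sets borel" by simp
  have indA [measurable]: "(indicator A :: _ \<Rightarrow> ennreal) \<in> borel_measurable borel"
    using A by (rule borel_measurable_indicator)
  have indB [measurable]: "(indicator ?B :: _ \<Rightarrow> ennreal) \<in> borel_measurable borel"
    by (rule borel_measurable_indicator) simp
  have "emeasure lborel ?B * emeasure (distr lborel borel T) A
      = (\<integral>\<^sup>+y. indicator ?B y * (\<integral>\<^sup>+x. indicator A (T x) \<partial>lborel) \<partial>lborel)"
  proof -
    have "emeasure (distr lborel borel T) A = (\<integral>\<^sup>+x. indicator A x \<partial>distr lborel borel T)"
      by simp
    also have "\<dots> = (\<integral>\<^sup>+x. indicator A (T x) \<partial>lborel)"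
      by (rule nn_integral_distr) simp_all
    finally show ?thesis
      by (subst nn_integral_multc) (simp_all add: borel_measurable_indicator)
  qed
  also have "\<dots> = (\<integral>\<^sup>+y. indicator ?B y * (\<integral>\<^sup>+x. indicator A (y + T x) \<partial>lborel) \<partial>lborel)"
  proof -
    have "(\<integral>\<^sup>+x. indicator A (T x) \<partial>lborel) = (\<integral>\<^sup>+x. indicator A (y + T x) \<partial>lborel)" for y
      using shift[of "\<lambda>x. indicator A (T x)" "inv T y"] by (simp add: linear_add[OF lin] TI)
    then show ?thesis by simp
  qed
  also have "\<dots> = (\<integral>\<^sup>+y. \<integral>\<^sup>+x. indicator ?B y * indicator A (y + T x) \<partial>lborel \<partial>lborel)"
    by (simp add: nn_integral_cmult)
  also have "\<dots> = (\<integral>\<^sup>+x. \<integral>\<^sup>+y. indicator ?B y * indicator A (y + T x) \<partial>lborel \<partial>lborel)"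
    by (rule lborel_pair.Fubini') measurable
  also have "\<dots> = (\<integral>\<^sup>+x. \<integral>\<^sup>+y. indicator ?B (y - T x) * indicator A y \<partial>lborel \<partial>lborel)"
  proof (rule nn_integral_cong)
    fix x :: "real^'n"
    show "(\<integral>\<^sup>+y. indicator ?B y * indicator A (y + T x) \<partial>lborel)
        = (\<integral>\<^sup>+y. indicator ?B (y - T x) * indicator A y \<partial>lborel)"
      using shift[of "\<lambda>y. indicator ?B (y - T x) * indicator A y" "T x"] by (simp add: add.commute)
  qed
  also have "\<dots> = (\<integral>\<^sup>+y. \<integral>\<^sup>+x. indicator ?B (y - T x) * indicator A y \<partial>lborel \<partial>lborel)"
    by (rule lborel_pair.Fubini') measurable
  also have "\<dots> = (\<integral>\<^sup>+y. emeasure lborel ?B * indicator A y \<partial>lborel)"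
  proof (rule nn_integral_cong)
    fix y :: "real^'n"
    have eq: "indicator ?B (y - T x) = (indicator ?B (- inv T y + x) :: ennreal)" for x
    proof -
      have "norm (y - T x) = norm (T (inv T y - x))"
        by (simp add: linear_diff[OF lin] TI)
      also have "\<dots> = norm (- inv T y + x)"
        by (simp add: orthogonal_transformation_norm[OF T] norm_minus_commute)
      finally show ?thesis by (simp add: indicator_def)
    qed
    show "(\<integral>\<^sup>+x. indicator ?B (y - T x) * indicator A y \<partial>lborel) = emeasure lborel ?B * indicator A y"
      using shift[of "indicator ?B" "- inv T y"] by (simp add: nn_integral_multc eq)
  qed
  also have "\<dots> = emeasure lborel ?B * emeasure lborel A"
    by (simp add: nn_integral_cmult)
  finally show "emeasure (distr lborel borel T) A = emeasure lborel A"
    using emeasure_lborel_ball_finite[of "0::real^'n" 1] content_ball_pos[of 1 "0::real^'n"]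
    by (auto simp: ennreal_mult_cancel_left measure_def)
qed simp

lemma distr_uniform_sphere_orthogonal:
  fixes T :: "real^'n \<Rightarrow> real^'n"
  assumes T: "orthogonal_transformation T"
  shows "distr (uniform_sphere r) borel T = uniform_sphere r"
proof -
  have lin: "linear T" using T by (rule orthogonal_transformation_linear)
  have meas [measurable]: "T \<in> borel_measurable borel"
    using lin by (intro borel_measurable_continuous_onI linear_continuous_on linear_conv_bounded_linear[THEN iffD1])
  let ?U = "uniform_measure lborel (ball (0::real^'n) 1)"
  let ?p = "\<lambda>x::real^'n. (r / norm x) *\<^sub>R x"
  have vb: "T -` ball 0 1 = ball 0 1"
    by (auto simp: orthogonal_transformation_norm[OF T])
  have "distr ?U borel T = ?U"
  proof (rule measure_eqI)
    fix A assume "A \<in> sets (distr ?U borel T)"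
    then have A [measurable]: "A \<in> sets borel" by simp
    have vA [measurable]: "T -` A \<in> sets borel"
      using measurable_sets[OF meas A] by simp
    have "emeasure lborel (ball 0 1 \<inter> T -` A) = emeasure lborel (T -` (ball 0 1 \<inter> A))"
      by (simp add: vb)
    also have "\<dots> = emeasure (distr lborel borel T) (ball 0 1 \<inter> A)"
      by (simp add: emeasure_distr)
    also have "\<dots> = emeasure lborel (ball 0 1 \<inter> A)"
      by (simp add: distr_lborel_orthogonal[OF T])
    finally show "emeasure (distr ?U borel T) A = emeasure ?U A"
      by (simp add: emeasure_distr)
  qed simp
  moreover have "distr (uniform_sphere r) borel T = distr (distr ?U borel T) borel ?p"
    by (simp add: uniform_sphere_def distr_distr o_def linear_cmul[OF lin]
        orthogonal_transformation_norm[OF T])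
  ultimately show ?thesis
    by (simp add: uniform_sphere_def)
qed

definition canonical_dir :: "(real^'n) measure" where
  "canonical_dir = measure_pmf (pmf_of_set (range (\<lambda>k. sqrt (real CARD('n)) *\<^sub>R axis k 1)))"

definition orthonormal_dir :: "real^'n^'n \<Rightarrow> (real^'n) measure" where
  "orthonormal_dir U = measure_pmf (pmf_of_set (range (\<lambda>k. sqrt (real CARD('n)) *\<^sub>R column k U)))"

definition nonuniform_dir :: "('n \<Rightarrow> real) \<Rightarrow> (real^'n) measure" where
  "nonuniform_dir p = measure_pmf (map_pmf (\<lambda>k. sqrt (1 / p k) *\<^sub>R axis k 1) (embed_pmf p))"

end

theory Submission
  imports Defs
begin

text \<open>
  A finite fourth moment of a distribution invariant under orthogonal maps depends on the
  direction only through its length: \<open>E(v\<bullet>x)^4 = a |x|^4\<close>. Polarization turns this into Wick's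
  formula for all mixed fourth moments, which contracts with the symmetric matrix \<open>S\<close> to
  \<open>Q = (a/3)(2S + tr(S) I)\<close>. The constant is \<open>a = 3\<close> for the Gaussian and \<open>a = 3d/(d+2)\<close> for
  the sphere of radius \<open>\<surd>d\<close>. The other three distributions are finitely supported, so \<open>Q\<close> is a
  finite sum.
\<close>

section \<open>Coordinatewise integration and outer products\<close>

text \<open>A vector is the finite sum of the images of its coordinates under the bounded linear
  maps \<open>axis i\<close>. Applied twice, this reduces the integral of a matrix to those of its
  entries.\<close>

lemma has_bochner_integral_vec:
  fixes f :: "'a \<Rightarrow> 'b::euclidean_space ^ 'n"
  assumes "\<And>i. has_bochner_integral M (\<lambda>x. f x $ i) (y $ i)"
  shows "has_bochner_integral M f y"
proof -
  have dec: "u = (\<Sum>i\<in>UNIV. axis i (u $ i))" for u :: "'b ^ 'n"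
    by (simp add: vec_eq_iff axis_def)
  have bl: "bounded_linear (axis i :: 'b \<Rightarrow> 'b ^ 'n)" for i
    by (intro linear_conv_bounded_linear[THEN iffD1] linearI) (auto simp: vec_eq_iff axis_def)
  have "has_bochner_integral M (\<lambda>x. \<Sum>i\<in>UNIV. axis i (f x $ i)) (\<Sum>i\<in>UNIV. axis i (y $ i))"
    by (intro has_bochner_integral_sum has_bochner_integral_bounded_linear[OF bl] assms)
  then show ?thesis
    by (simp flip: dec)
qed

lemma sum_if_const: "(\<Sum>x\<in>A. if c then f x else 0) = (if c then sum f A else 0)"
  by simp

text \<open>This exhibits each entry of \<open>Qmat\<close> as a linear combination of mixed fourth
  moments of the direction, with the entries of \<open>S\<close> as coefficients.\<close>

lemma sandwich_outer_nth:
  "(outer v v ** S ** outer v v) $ i $ j = (\<Sum>k\<in>UNIV. \<Sum>l\<in>UNIV. S $ k $ l * (v $ i * v $ k * v $ l * v $ j))"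
  by (subst sum.swap) (simp add: matrix_matrix_mult_def outer_def sum_distrib_right sum_distrib_left mult_ac)

text \<open>Transposition is bounded linear and undone by a second transposition, so it commutes
  with the Bochner integral even where that takes its default value 0.\<close>

lemma symmetric_integral_outer:
  "transpose (\<integral>x. outer (g x) (g x) \<partial>M) = (\<integral>x. outer (g x) (g x) \<partial>M)"
proof -
  have bl: "bounded_linear (transpose :: real^'n^'m \<Rightarrow> real^'m^'n)"
    by (intro linear_conv_bounded_linear[THEN iffD1] linearI) (auto simp: vec_eq_iff transpose_def)
  have "(\<integral>x. transpose (outer (g x) (g x)) \<partial>M) = transpose (\<integral>x. outer (g x) (g x) \<partial>M)"
    by (rule integral_bounded_linear'[OF bl bl]) simp
  moreover have "transpose (outer v v) = outer v v" for v :: "real^'a"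
    by (simp add: vec_eq_iff transpose_def outer_def mult.commute)
  ultimately show ?thesis by simp
qed

subsection \<open>Rotation invariant fourth moments\<close>

text \<open>Choose an orthogonal \<open>T\<close> that turns \<open>x\<close> into a multiple of
  \<open>e\<close>. Then \<open>v \<bullet> x\<close> equals
  \<open>norm x * (T v \<bullet> e)\<close>, and \<open>T v\<close> has the same law as
  \<open>v\<close>.\<close>

lemma rotation_invariant_moment4:
  fixes P :: "(real^'n) measure"
  assumes inv: "\<And>T. orthogonal_transformation T \<Longrightarrow> distr P borel T = P"
    and e: "norm e = 1" "has_bochner_integral P (\<lambda>v. (v \<bullet> e) ^ 4) a"
  shows "has_bochner_integral P (\<lambda>v. (v \<bullet> x) ^ 4) (a * (x \<bullet> x)\<^sup>2)"
proof -
  have "norm x = norm (norm x *\<^sub>R e)" using e by simp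
  then obtain T where T: "orthogonal_transformation T" "T x = norm x *\<^sub>R e"
    by (rule orthogonal_transformation_exists)
  \<comment> \<open>Invariance also fixes the sigma-algebra of \<open>P\<close>, since
    \<open>distr P borel T\<close> carries the Borel sets.\<close>
  have "sets P = sets borel"
    using arg_cong[OF inv[OF T(1)], of sets] by simp
  then have "T \<in> P \<rightarrow>\<^sub>M borel"
    using orthogonal_transformation_linear[OF T(1)]
    by (simp add: borel_measurable_continuous_onI linear_continuous_on linear_conv_bounded_linear
        cong: measurable_cong_sets)
  moreover have "has_bochner_integral (distr P borel T) (\<lambda>v. (v \<bullet> e) ^ 4) a"
    using e(2) by (simp add: inv[OF T(1)])
  ultimately have "has_bochner_integral P (\<lambda>v. (T v \<bullet> e) ^ 4) a"
    by (simp add: has_bochner_integral_iff integrable_distr_eq integral_distr)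
  then have "has_bochner_integral P (\<lambda>v. (T v \<bullet> e) ^ 4 * norm x ^ 4) (a * norm x ^ 4)"
    by (rule has_bochner_integral_mult_left)
  moreover have "(T v \<bullet> e) ^ 4 * norm x ^ 4 = (v \<bullet> x) ^ 4" for v
  proof -
    have "v \<bullet> x = T v \<bullet> T x"
      using T(1) by (simp add: orthogonal_transformation_def)
    then show ?thesis by (simp add: T(2) power_mult_distrib mult.commute)
  qed
  moreover have "norm x ^ 4 = (x \<bullet> x)\<^sup>2"
    by (simp flip: power2_norm_eq_inner)
  ultimately show ?thesis by simp
qed

text \<open>Polarization recovers a symmetric 4-linear form from its values on the diagonal. It is
  applied to both sides of the pure fourth moment formula.\<close>

lemma rotation_invariant_wick:
  fixes P :: "(real^'n) measure"
  assumes inv: "\<And>T. orthogonal_transformation T \<Longrightarrow> distr P borel T = P"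
    and e: "norm e = 1" "has_bochner_integral P (\<lambda>v. (v \<bullet> e) ^ 4) a"
  shows "has_bochner_integral P (\<lambda>v. (v \<bullet> x) * (v \<bullet> y) * (v \<bullet> z) * (v \<bullet> w))
    (a / 3 * ((x \<bullet> y) * (z \<bullet> w) + (x \<bullet> z) * (y \<bullet> w) + (x \<bullet> w) * (y \<bullet> z)))"
proof -
  note m = rotation_invariant_moment4[OF assms]
  \<comment> \<open>The sign of \<open>x\<close> is fixed and the other three vary; each term is
    weighted by the product of its signs. The product of the four inner products occurs 4! = 24
    times in each of the 8 fourth powers, hence 192.\<close>
  define q where "q r = (r (x + y + z + w) - r (x + y + z - w) - r (x + y - z + w) - r (x - y + z + w)
    + r (x + y - z - w) + r (x - y + z - w) + r (x - y - z + w) - r (x - y - z - w)) / 192"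
    for r :: "real^'n \<Rightarrow> real"
  have "has_bochner_integral P (\<lambda>v. q (\<lambda>u. (v \<bullet> u) ^ 4)) (q (\<lambda>u. a * (u \<bullet> u)\<^sup>2))"
    unfolding q_def
    by (intro has_bochner_integral_divide has_bochner_integral_add has_bochner_integral_diff m)
  moreover have "q (\<lambda>u. (v \<bullet> u) ^ 4) = (v \<bullet> x) * (v \<bullet> y) * (v \<bullet> z) * (v \<bullet> w)" for v
    by (simp add: q_def inner_simps power4_eq_xxxx field_simps)
  moreover have "q (\<lambda>u. a * (u \<bullet> u)\<^sup>2)
      = a / 3 * ((x \<bullet> y) * (z \<bullet> w) + (x \<bullet> z) * (y \<bullet> w) + (x \<bullet> w) * (y \<bullet> z))"
    by (simp add: q_def inner_simps inner_commute power2_eq_square field_simps)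
  ultimately show ?thesis by simp
qed

text \<open>Contracting Wick's formula with \<open>S\<close> turns its three pairings into
  \<open>S\<close>, its transpose and \<open>trace S *\<^sub>R mat 1\<close>; symmetry merges the
  first two into \<open>2 *\<^sub>R S\<close>.\<close>

lemma Qmat_rotation_invariant:
  fixes P :: "(real^'n) measure"
  assumes inv: "\<And>T. orthogonal_transformation T \<Longrightarrow> distr P borel T = P"
    and e: "norm e = 1" "has_bochner_integral P (\<lambda>v. (v \<bullet> e) ^ 4) a"
    and S: "transpose S = S"
  shows "Qmat S P = (a / 3) *\<^sub>R (2 *\<^sub>R S + trace S *\<^sub>R mat 1)"
  unfolding Qmat_def
proof (intro has_bochner_integral_integral_eq has_bochner_integral_vec)
  fix i j :: 'n
  have sym: "S $ j $ i = S $ i $ j"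
    using arg_cong[OF S, of "\<lambda>A. A $ i $ j"] by (simp add: transpose_def)
  have delta: "(axis k 1 :: real^'n) \<bullet> axis l 1 = (if k = l then 1 else 0)" for k l :: 'n
    by (simp add: inner_axis_axis)
  \<comment> \<open>The products of Kronecker deltas become nested conditionals, so that both sums
    collapse; \<open>sum_if_const\<close> moves a test that is constant in the summation index out
    of the sum.\<close>
  have "(\<Sum>k\<in>UNIV. \<Sum>l\<in>UNIV. S $ k $ l * (a / 3 * ((axis i 1 \<bullet> (axis k 1 :: real^'n)) * (axis l 1 \<bullet> (axis j 1 :: real^'n))
      + (axis i 1 \<bullet> (axis l 1 :: real^'n)) * (axis k 1 \<bullet> (axis j 1 :: real^'n))
      + (axis i 1 \<bullet> (axis j 1 :: real^'n)) * (axis k 1 \<bullet> (axis l 1 :: real^'n)))))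
    = a / 3 * (\<Sum>k\<in>UNIV. \<Sum>l\<in>UNIV. (if i = k then if l = j then S $ k $ l else 0 else 0)
      + (if k = j then if i = l then S $ k $ l else 0 else 0)
      + (if k = l then if i = j then S $ k $ l else 0 else 0))" (is "?D = _")
    unfolding sum_distrib_left by (intro sum.cong) (auto simp: delta)
  also have "\<dots> = ((a / 3) *\<^sub>R (2 *\<^sub>R S + trace S *\<^sub>R mat 1)) $ i $ j"
    by (simp add: sum.distrib sum_if_const trace_def mat_def sym)
  finally have eq: "((a / 3) *\<^sub>R (2 *\<^sub>R S + trace S *\<^sub>R mat 1)) $ i $ j = ?D" ..
  have "has_bochner_integral P
     (\<lambda>v. \<Sum>k\<in>UNIV. \<Sum>l\<in>UNIV. S $ k $ l * ((v \<bullet> axis i 1) * (v \<bullet> axis k 1) * (v \<bullet> axis l 1) * (v \<bullet> axis j 1)))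
     (((a / 3) *\<^sub>R (2 *\<^sub>R S + trace S *\<^sub>R mat 1)) $ i $ j)"
    unfolding eq
    by (intro has_bochner_integral_sum has_bochner_integral_mult_right rotation_invariant_wick[OF inv e])
  then show "has_bochner_integral P (\<lambda>v. (outer v v ** S ** outer v v) $ i $ j)
     (((a / 3) *\<^sub>R (2 *\<^sub>R S + trace S *\<^sub>R mat 1)) $ i $ j)"
    by (simp add: sandwich_outer_nth inner_axis)
qed

section \<open>Gaussian and spherical directions: invariance and fourth moments\<close>

text \<open>The product density depends on \<open>v\<close> only through \<open>norm v\<close>, and
  Lebesgue measure is itself invariant.\<close>

lemma distr_gaussian_dir_orthogonal:
  fixes T :: "real^'n \<Rightarrow> real^'n"
  assumes T: "orthogonal_transformation T"
  shows "distr gaussian_dir borel T = gaussian_dir"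
proof -
  let ?g = "\<lambda>v::real^'n. ennreal (\<Prod>i\<in>UNIV. std_normal_density (v $ i))"
  have [measurable]: "T \<in> borel_measurable borel"
    using orthogonal_transformation_linear[OF T]
    by (simp add: borel_measurable_continuous_onI linear_continuous_on linear_conv_bounded_linear)
  have [measurable]: "?g \<in> borel_measurable borel"
    by measurable
  have g: "?g v = ennreal ((1 / sqrt (2 * pi)) ^ CARD('n) * exp (- (norm v)\<^sup>2 / 2))" for v
  proof -
    have "(\<Prod>i\<in>UNIV. exp (- (v $ i)\<^sup>2 / 2)) = exp (\<Sum>i\<in>UNIV. - (v $ i)\<^sup>2 / 2)"
      by (simp add: exp_sum)
    also have "(\<Sum>i\<in>UNIV. - (v $ i)\<^sup>2 / 2) = - (norm v)\<^sup>2 / 2"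
      unfolding power2_norm_eq_inner
      by (simp add: inner_vec_def power2_eq_square sum_negf sum_divide_distrib)
    finally show ?thesis
      unfolding std_normal_density_def prod.distrib by simp
  qed
  have "distr gaussian_dir borel T = distr (density lborel (\<lambda>v. ?g (T v))) borel T"
    by (simp only: g orthogonal_transformation_norm[OF T] gaussian_dir_def)
  also have "\<dots> = density (distr lborel borel T) ?g"
    by (rule density_distr[symmetric]) auto
  finally show ?thesis
    by (simp only: distr_lborel_orthogonal[OF T] gaussian_dir_def)
qed

text \<open>The coordinates are independent: the factor of coordinate \<open>k\<close> is the fourth
  standard normal moment, all others are total masses. Working with nonnegative integrals gives
  integrability and value together.\<close>

lemma gaussian_dir_moment4:
  "has_bochner_integral (gaussian_dir :: (real^'n) measure) (\<lambda>v. (v \<bullet> axis k 1) ^ 4) 3"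
proof (rule has_bochner_integral_nn_integral)
  \<comment> \<open>The even moment formula gives 4! / (2^2 * 2!) = 3.\<close>
  have m4: "(\<integral>\<^sup>+x. ennreal (std_normal_density x * x ^ 4) \<partial>lborel) = 3"
    using std_normal_moment_even[of 2]
    by (subst nn_integral_eq_integral)
      (auto simp: has_bochner_integral_iff fact_numeral zero_le_even_power)
  have m0: "(\<integral>\<^sup>+x. ennreal (std_normal_density x) \<partial>lborel) = 1"
    using std_normal_moment_even[of 0]
    by (subst nn_integral_eq_integral) (auto simp: has_bochner_integral_iff)
  \<comment> \<open>The monomial is absorbed into the factor of \<open>axis k 1\<close>, so the
    integrand is a product over \<open>Basis\<close> and Fubini for \<open>lborel\<close>
    applies.\<close>
  define h where "h b x = ennreal (std_normal_density x * (if b = axis k 1 then x ^ 4 else 1))"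
    for b :: "real^'n" and x
  have Basis: "(Basis :: (real^'n) set) = range (\<lambda>i. axis i 1)"
    by (auto simp: Basis_vec_def)
  have inj: "inj (\<lambda>i. axis i 1 :: real^'n)"
    by (auto simp: inj_on_def axis_eq_axis)
  have "(\<integral>\<^sup>+v. ennreal ((v \<bullet> axis k 1) ^ 4) \<partial>(gaussian_dir :: (real^'n) measure))
      = (\<integral>\<^sup>+v. (\<Prod>b\<in>Basis. h b (v \<bullet> b)) \<partial>lborel)"
    unfolding gaussian_dir_def
  proof (subst nn_integral_density, measurable, intro nn_integral_cong)
    fix v :: "real^'n"
    have "(\<Prod>b\<in>Basis. h b (v \<bullet> b)) = (\<Prod>i\<in>UNIV. h (axis i 1) (v $ i))"
      by (simp add: Basis prod.reindex[OF inj] inner_axis)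
    also have "\<dots> = ennreal (\<Prod>i\<in>UNIV. std_normal_density (v $ i) * (if i = k then (v $ i) ^ 4 else 1))"
      unfolding h_def by (subst prod_ennreal) (auto simp: axis_eq_axis zero_le_even_power)
    also have "\<dots> = ennreal (\<Prod>i\<in>UNIV. std_normal_density (v $ i)) * ennreal ((v \<bullet> axis k 1) ^ 4)"
      by (simp add: prod.distrib inner_axis ennreal_mult prod_nonneg zero_le_even_power)
    finally show "ennreal (\<Prod>i\<in>UNIV. std_normal_density (v $ i)) * ennreal ((v \<bullet> axis k 1) ^ 4)
        = (\<Prod>b\<in>Basis. h b (v \<bullet> b))" ..
  qed
  also have "\<dots> = (\<Prod>b\<in>Basis. \<integral>\<^sup>+x. h b x \<partial>lborel)"
    by (rule nn_integral_lborel_prod) (auto simp: h_def)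
  also have "\<dots> = (\<Prod>i\<in>UNIV. if i = k then 3 else 1)"
    unfolding Basis prod.reindex[OF inj]
    by (intro prod.cong) (auto simp: h_def[abs_def] axis_eq_axis m4 m0)
  finally show "(\<integral>\<^sup>+v. ennreal ((v \<bullet> axis k 1) ^ 4) \<partial>(gaussian_dir :: (real^'n) measure)) = ennreal 3"
    by simp
qed (auto simp: gaussian_dir_def zero_le_even_power)

text \<open>The moment is found by integrating the fourth power of the norm, expanded in coordinates.\<close>

lemma uniform_sphere_moment4:
  fixes k :: "'n::finite"
  assumes r: "0 \<le> r"
  shows "has_bochner_integral (uniform_sphere r :: (real^'n) measure) (\<lambda>v. (v \<bullet> axis k 1) ^ 4)
    (3 * r ^ 4 / (real CARD('n) * (real CARD('n) + 2)))"
proof -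
  let ?P = "uniform_sphere r :: (real^'n) measure"
  let ?d = "real CARD('n)"
  interpret prob_space ?P by (rule prob_space_uniform_sphere)
  have ms: "sets ?P = sets borel" by (simp add: uniform_sphere_def)
  \<comment> \<open>Almost surely a coordinate is at most the radius in absolute value, so the
    moment exists. Its value \<open>a\<close> stays unknown until the norm is integrated.\<close>
  have "AE v in ?P. norm ((v \<bullet> axis k 1) ^ 4) \<le> r ^ 4"
    using AE_uniform_sphere[OF r]
  proof eventually_elim
    case (elim v)
    have "\<bar>v \<bullet> axis k 1\<bar> \<le> r"
      using Cauchy_Schwarz_ineq2[of v "axis k 1"] elim by simp
    then have "\<bar>v \<bullet> axis k 1\<bar> ^ 4 \<le> r ^ 4"
      by (intro power_mono) auto
    then show ?case
      by (simp add: power_abs)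
  qed
  then have "integrable ?P (\<lambda>v. (v \<bullet> axis k 1) ^ 4)"
    by (intro integrable_const_bound) (auto cong: measurable_cong_sets simp: ms)
  then obtain a where a: "has_bochner_integral ?P (\<lambda>v. (v \<bullet> axis k 1) ^ 4) a"
    by (auto simp: has_bochner_integral_iff)
  have wick: "has_bochner_integral ?P (\<lambda>v. (v \<bullet> x) * (v \<bullet> y) * (v \<bullet> z) * (v \<bullet> w))
      (a / 3 * ((x \<bullet> y) * (z \<bullet> w) + (x \<bullet> z) * (y \<bullet> w) + (x \<bullet> w) * (y \<bullet> z)))" for x y z w
    by (rule rotation_invariant_wick[OF distr_uniform_sphere_orthogonal _ a]) auto
  have "has_bochner_integral ?P
      (\<lambda>v. \<Sum>i\<in>UNIV. \<Sum>j\<in>UNIV. (v \<bullet> axis i 1) * (v \<bullet> axis i 1) * (v \<bullet> axis j 1) * (v \<bullet> axis j 1))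
      (\<Sum>i\<in>(UNIV::'n set). \<Sum>j\<in>(UNIV::'n set). a / 3 * (1 + (if j = i then 2 else 0)))"
  proof (intro has_bochner_integral_sum)
    fix i j :: 'n
    show "has_bochner_integral ?P
      (\<lambda>v. (v \<bullet> axis i 1) * (v \<bullet> axis i 1) * (v \<bullet> axis j 1) * (v \<bullet> axis j 1))
      (a / 3 * (1 + (if j = i then 2 else 0)))"
      using wick[of "axis i 1" "axis i 1" "axis j 1" "axis j 1"]
      by (cases "i = j") (simp_all add: inner_axis_axis)
  qed
  moreover have "(\<Sum>i\<in>UNIV. \<Sum>j\<in>UNIV. (v \<bullet> axis i 1) * (v \<bullet> axis i 1) * (v \<bullet> axis j 1) * (v \<bullet> axis j 1))
      = norm v ^ 4" for v :: "real^'n"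
  proof -
    have "norm v ^ 4 = (v \<bullet> v) * (v \<bullet> v)"
      by (simp add: power2_norm_eq_inner[symmetric])
    then show ?thesis
      by (simp only: inner_vec_def[of v v] sum_product) (simp add: inner_axis mult.assoc)
  qed
  \<comment> \<open>In units of \<open>a / 3\<close>, the \<open>?d\<close> diagonal pairs count 3
    and the remaining pairs count 1, which makes \<open>?d * (?d + 2)\<close>.\<close>
  moreover have "(\<Sum>i\<in>(UNIV::'n set). \<Sum>j\<in>(UNIV::'n set). a / 3 * (1 + (if j = i then 2 else 0)))
      = a / 3 * (?d * (?d + 2))"
    unfolding sum_distrib_left[symmetric] by (simp add: sum.distrib algebra_simps)
  ultimately have "(\<integral>v. norm v ^ 4 \<partial>?P) = a / 3 * (?d * (?d + 2))"
    by (simp add: has_bochner_integral_iff)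
  moreover have "(\<integral>v. norm v ^ 4 \<partial>?P) = (\<integral>v. r ^ 4 \<partial>?P)"
    using AE_uniform_sphere[OF r]
    by (intro integral_cong_AE) (auto cong: measurable_cong_sets simp: ms)
  ultimately have "r ^ 4 = a / 3 * (?d * (?d + 2))"
    by (simp add: prob_space)
  moreover have "?d * (?d + 2) > 0" by simp
  ultimately have "a = 3 * r ^ 4 / (?d * (?d + 2))"
    by (simp add: field_simps)
  with a show ?thesis by simp
qed

subsection \<open>Discrete directions\<close>

text \<open>With u_k the columns of \<open>U\<close>, both sides are \<open>CARD('n)\<close> times
  the sum of (u_k^T S u_k) u_k u_k^T.\<close>

lemma Qmat_orthonormal_dir:
  fixes S U :: "real^'n^'n"
  assumes U: "orthogonal_matrix U"
  shows "Qmat S (orthonormal_dir U)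
    = real CARD('n) *\<^sub>R (U ** diag_part (transpose U ** S ** U) ** transpose U)"
proof -
  let ?u = "\<lambda>k. sqrt (real CARD('n)) *\<^sub>R column k U"
  \<comment> \<open>\<open>pmf_of_set\<close> is uniform on a set, so each column has weight
    \<open>1 / CARD('n)\<close> only if the columns are distinct.\<close>
  have inj: "inj ?u"
  proof (rule injI)
    fix k l assume "?u k = ?u l"
    then have "\<not> orthogonal (column k U) (column l U)"
      using U by (simp add: orthogonal_matrix_orthonormal_columns orthogonal_def norm_eq_1)
    then show "k = l"
      using U by (auto simp: orthogonal_matrix_orthonormal_columns)
  qed
  have "Qmat S (orthonormal_dir U)
      = (\<Sum>v\<in>range ?u. (1 / real CARD('n)) *\<^sub>R (outer v v ** S ** outer v v))"
    unfolding Qmat_def orthonormal_dir_def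
    by (subst integral_measure_pmf[of "range ?u"]) (auto simp: card_image[OF inj])
  also have "\<dots> = (\<Sum>k\<in>UNIV. (1 / real CARD('n)) *\<^sub>R (outer (?u k) (?u k) ** S ** outer (?u k) (?u k)))"
    by (simp add: sum.reindex[OF inj])
  \<comment> \<open>Each of the two outer products contributes a factor \<open>CARD('n)\<close>, and
    the probability cancels one of them.\<close>
  also have "\<dots> = (\<Sum>k\<in>UNIV. real CARD('n) *\<^sub>R (outer (column k U) (column k U) ** S ** outer (column k U) (column k U)))"
  proof (intro sum.cong refl)
    fix k
    have "outer (?u k) (?u k) = real CARD('n) *\<^sub>R outer (column k U) (column k U)"
      by (simp add: vec_eq_iff outer_def)
    then show "(1 / real CARD('n)) *\<^sub>R (outer (?u k) (?u k) ** S ** outer (?u k) (?u k))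
      = real CARD('n) *\<^sub>R (outer (column k U) (column k U) ** S ** outer (column k U) (column k U))"
      by (simp add: matrix_scalar_ac flip: scalar_matrix_assoc)
  qed
  also have "\<dots> = real CARD('n) *\<^sub>R (U ** diag_part (transpose U ** S ** U) ** transpose U)"
  proof -
    have "(\<Sum>k\<in>UNIV. (outer (column k U) (column k U) ** S ** outer (column k U) (column k U)) $ i $ j)
      = (U ** diag_part (transpose U ** S ** U) ** transpose U) $ i $ j" for i j
    proof -
      have diag: "(U ** diag_part A) $ i $ k = U $ i $ k * A $ k $ k" for A k
        by (simp add: matrix_matrix_mult_def diag_part_def diag_mat_def if_distrib cong: if_cong)
      have mult_transpose: "(A ** transpose U) $ i $ j = (\<Sum>k\<in>UNIV. A $ i $ k * U $ j $ k)" for A :: "real^'n^'n"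
        by (simp add: matrix_matrix_mult_def transpose_def)
      have quad: "(transpose U ** S ** U) $ k $ k = (\<Sum>a\<in>UNIV. \<Sum>b\<in>UNIV. S $ a $ b * (U $ a $ k * U $ b $ k))" for k
        by (subst sum.swap) (simp add: matrix_matrix_mult_def transpose_def sum_distrib_left sum_distrib_right mult_ac)
      have "(U ** diag_part (transpose U ** S ** U) ** transpose U) $ i $ j
        = (\<Sum>k\<in>UNIV. U $ i $ k * (transpose U ** S ** U) $ k $ k * U $ j $ k)"
        by (simp only: mult_transpose diag)
      then show ?thesis
        unfolding quad sandwich_outer_nth
        by (simp add: column_def sum_distrib_left sum_distrib_right mult_ac)
    qed
    then show ?thesis
      by (simp add: vec_eq_iff sum_distrib_left[symmetric])
  qed
  finally show ?thesis .
qed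

text \<open>The canonical basis is the orthonormal basis formed by the columns of the identity
  matrix.\<close>

lemma Qmat_canonical_dir:
  fixes S :: "real^'n^'n"
  shows "Qmat S canonical_dir = real CARD('n) *\<^sub>R diag_part S"
proof -
  have "column k (mat 1) = (axis k 1 :: real^'n)" for k
    by (simp add: vec_eq_iff column_def mat_def axis_def)
  then have "canonical_dir = orthonormal_dir (mat 1 :: real^'n^'n)"
    by (simp add: canonical_dir_def orthonormal_dir_def)
  then show ?thesis
    using Qmat_orthonormal_dir[OF orthogonal_matrix_id, of S]
    by (simp add: transpose_mat)
qed

text \<open>Each outer product carries \<open>1 / p k\<close>, and the probability
  \<open>p k\<close> cancels one of the two factors. The sandwich of \<open>axis k 1\<close> keeps
  only the diagonal entry \<open>S $ k $ k\<close>.\<close>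

lemma Qmat_nonuniform_dir:
  fixes S :: "real^'n^'n"
  assumes p: "\<And>k. 0 < p k" "(\<Sum>k\<in>UNIV. p k) = 1"
  shows "Qmat S (nonuniform_dir p) = diag_mat (\<lambda>k. S $ k $ k / p k)"
proof -
  let ?e = "\<lambda>k. sqrt (1 / p k) *\<^sub>R (axis k 1 :: real^'n)"
  have pmf: "pmf (embed_pmf p) k = p k" for k
    by (rule pmf_embed_pmf)
      (use p in \<open>auto simp: less_imp_le nn_integral_count_space_finite sum_ennreal\<close>)
  have "Qmat S (nonuniform_dir p) = (\<Sum>k\<in>UNIV. p k *\<^sub>R (outer (?e k) (?e k) ** S ** outer (?e k) (?e k)))"
    unfolding Qmat_def nonuniform_dir_def
    by (simp add: integral_measure_pmf[of UNIV] pmf)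
  also have "\<dots> = (\<Sum>k\<in>UNIV. diag_mat (\<lambda>i. if i = k then S $ k $ k / p k else 0))"
  proof (intro sum.cong refl)
    fix k
    have "p k \<noteq> 0" "0 \<le> p k" using p(1)[of k] by auto
    then have o: "outer (?e k) (?e k) = (1 / p k) *\<^sub>R outer (axis k 1) (axis k 1)"
      by (simp add: vec_eq_iff outer_def real_sqrt_divide)
    have "outer (axis k 1) (axis k 1) ** S ** outer (axis k 1) (axis k 1)
        = diag_mat (\<lambda>i. if i = k then S $ k $ k else 0)"
    proof -
      have "(outer (axis k 1) (axis k 1) ** S ** outer (axis k 1) (axis k 1)) $ i $ j
        = (\<Sum>a\<in>UNIV. \<Sum>b\<in>UNIV. if a = k then if b = k then if i = k \<and> j = k then S $ k $ k else 0 else 0 else 0)"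
        for i j
        unfolding sandwich_outer_nth by (intro sum.cong) (auto simp: axis_def)
      then show ?thesis
        by (auto simp: vec_eq_iff diag_mat_def sum_if_const)
    qed
    then show "p k *\<^sub>R (outer (?e k) (?e k) ** S ** outer (?e k) (?e k))
        = diag_mat (\<lambda>i. if i = k then S $ k $ k / p k else 0)"
      using \<open>p k \<noteq> 0\<close> unfolding o
      by (simp add: matrix_scalar_ac flip: scalar_matrix_assoc) (simp add: vec_eq_iff diag_mat_def)
  qed
  also have "\<dots> = diag_mat (\<lambda>k. S $ k $ k / p k)"
    by (simp add: vec_eq_iff diag_mat_def)
  finally show ?thesis .
qed

section \<open>The five direction distributions together\<close>

theorem proposition3p5:
  fixes Z :: "'z measure"
    and f :: "real^'d \<Rightarrow> 'z \<Rightarrow> real"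
    and F :: "real^'d \<Rightarrow> real"
    and \<theta>s :: "real^'d"
    and L\<^sub>f :: real
    and S :: "real^'d^'d"
  assumes Z: "prob_space Z"
    and f_convex: "\<And>\<zeta>. \<zeta> \<in> space Z \<Longrightarrow> convex_on UNIV (\<lambda>\<theta>. f \<theta> \<zeta>)"
    and f_diff: "\<And>\<zeta>. \<zeta> \<in> space Z \<Longrightarrow> twice_differentiable (\<lambda>\<theta>. f \<theta> \<zeta>)"
    and F: "\<And>\<theta>. has_bochner_integral Z (f \<theta>) (F \<theta>)"
    and \<theta>s: "is_arg_min F (\<lambda>_. True) \<theta>s"
    and A1_smooth: "twice_differentiable F" "continuous_on UNIV (hess F)"
    and A1_convex: "convex_on UNIV F"
    and A1_hess: "\<And>\<theta>. 0 \<preceq> hess F \<theta> \<and> hess F \<theta> \<preceq> L\<^sub>f *\<^sub>R mat 1"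
    and A1_local: "\<exists>\<delta>\<^sub>1>0. \<exists>\<mu>>0. \<forall>\<theta>\<in>ball \<theta>s \<delta>\<^sub>1. \<mu> *\<^sub>R mat 1 \<preceq> hess F \<theta>"
    and A2_unbiased: "\<And>\<theta>. has_bochner_integral Z (\<lambda>\<zeta>. grad (\<lambda>t. f t \<zeta>) \<theta>) (grad F \<theta>)"
    and A2_moment: "\<exists>\<delta>>0. \<delta> \<le> 2 \<and> (\<exists>M>0. \<forall>\<theta>.
        (\<integral>\<^sup>+\<zeta>. ennreal (norm (grad (\<lambda>t. f t \<zeta>) \<theta> - grad F \<theta>) powr (2 + \<delta>)) \<partial>Z)
          \<le> ennreal (M * (norm (\<theta> - \<theta>s) powr (2 + \<delta>) + 1)))"
    and A3_lipschitz: "\<exists>L\<^sub>h>0. \<forall>\<theta> \<theta>'.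
        (\<integral>\<^sup>+\<zeta>. ennreal ((spectral_norm (hess (\<lambda>t. f t \<zeta>) \<theta> - hess (\<lambda>t. f t \<zeta>) \<theta>'))\<^sup>2) \<partial>Z)
          \<le> ennreal (L\<^sub>h * (norm (\<theta> - \<theta>'))\<^sup>2)"
    and A3_square: "\<exists>L\<^sub>p>0.
        (\<integral>\<^sup>+\<zeta>. ennreal (spectral_norm (hess (\<lambda>t. f t \<zeta>) \<theta>s ** hess (\<lambda>t. f t \<zeta>) \<theta>s
                                     - hess F \<theta>s ** hess F \<theta>s)) \<partial>Z)
          \<le> ennreal L\<^sub>p"
    and S: "S = (\<integral>\<zeta>. outer (grad (\<lambda>t. f t \<zeta>) \<theta>s) (grad (\<lambda>t. f t \<zeta>) \<theta>s) \<partial>Z)"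
  shows "Qmat S gaussian_dir = 2 *\<^sub>R S + trace S *\<^sub>R mat 1
    \<and> Qmat S (uniform_sphere (sqrt (real CARD('d))))
        = (real CARD('d) / (real CARD('d) + 2)) *\<^sub>R (2 *\<^sub>R S + trace S *\<^sub>R mat 1)
    \<and> Qmat S canonical_dir = real CARD('d) *\<^sub>R diag_part S
    \<and> (\<forall>U. orthogonal_matrix U \<longrightarrow>
        Qmat S (orthonormal_dir U)
          = real CARD('d) *\<^sub>R (U ** diag_part (transpose U ** S ** U) ** transpose U))
    \<and> (\<forall>p. (\<forall>k. 0 < p k) \<and> (\<Sum>k\<in>UNIV. p k) = 1 \<longrightarrow>
        Qmat S (nonuniform_dir p) = diag_mat (\<lambda>k. S $ k $ k / p k))"
proof -
  let ?d = "real CARD('d)"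
  have sym: "transpose S = S"
    unfolding S by (rule symmetric_integral_outer)
  have "Qmat S gaussian_dir = 2 *\<^sub>R S + trace S *\<^sub>R mat 1"
    using Qmat_rotation_invariant[OF distr_gaussian_dir_orthogonal _ gaussian_dir_moment4 sym]
    by simp
  moreover have "Qmat S (uniform_sphere (sqrt ?d))
      = (?d / (?d + 2)) *\<^sub>R (2 *\<^sub>R S + trace S *\<^sub>R mat 1)"
  proof -
    \<comment> \<open>For radius \<open>sqrt ?d\<close> the fourth moment is
      \<open>a = 3 * ?d * ?d / (?d * (?d + 2))\<close>, so the prefactor \<open>a / 3\<close> is
      \<open>?d / (?d + 2)\<close>.\<close>
    have "sqrt ?d ^ 4 = ?d * ?d"
      by (simp add: power4_eq_xxxx)
    moreover have "3 * (x * x) / (x * (x + 2)) / 3 = x / (x + 2)" if "0 < x" for x :: real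
    proof -
      have "x \<noteq> 0" "x + 2 \<noteq> 0" using that by auto
      then show ?thesis by (simp add: divide_simps)
    qed
    ultimately have "3 * sqrt ?d ^ 4 / (?d * (?d + 2)) / 3 = ?d / (?d + 2)"
      by simp
    then show ?thesis
      using Qmat_rotation_invariant[OF distr_uniform_sphere_orthogonal _
          uniform_sphere_moment4[where r = "sqrt ?d"] sym]
      by simp
  qed
  ultimately show ?thesis
    by (simp add: Qmat_canonical_dir Qmat_orthonormal_dir Qmat_nonuniform_dir)
qed

end
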